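(* Let $I \subseteq \mathbb{R}$ be an interval, and suppose that $r : I \to \mathbb{R}$ and $s : I \to (0,\infty)$ are measurable functions. Consider the functional $$T(F) = \frac{\mathbb{E}_F[r(Y)]}{\mathbb{E}_F[s(Y)]},$$ which is assumed to take values in $I$ on the classes of distributions considered below. Then the following holds. (a) The functional $T$ is elicitable relative to the class of the probability measures $F$ on $I$ for which $\mathbb{E}_F[r(Y)]$, $\mathbb{E}_F[s(Y)]$ and $\mathbb{E}_F[Y s(Y)]$ exist and are finite. (b) If $S$ is of the form $$S(x,y) = s(y)\,(\phi(y) - \phi(x)) - \phi'(x)\,(r(y) - x\, s(y)) + \phi'(y)\,(r(y) - y\, s(y)), \qquad x, y \in I, \qquad (\ast)$$ where $\phi$ is a convex function on $I$ with subgradient $\phi'$, then it is consistent for the functional $T$ relative to the class of the probability measures $F$ on $I$ for which $\mathbb{E}_F[r(Y)]$, $\mathbb{E}_F[s(Y)]$, $\mathbb{E}_F[r(Y)\phi'(Y)]$, $\mathbb{E}_F[s(Y)\phi(Y)]$ and $\mathbb{E}_F[Y s(Y)\phi'(Y)]$ exist and are finite. If $\phi$ is strictly convex, then $S$ is strictly consistent for $T$ relative to this class. (c) Suppose that the scoring function $S : I \times I \to [0,\infty)$ satisfies the following assumptions: (S0) $S(x,y) \ge 0$ with equality if $x = y$; (S1) $S(x,y)$ is continuous in $x$; (S2) the partial derivative $S_{(1)}(x,y)$ of $S$ with respect to its first argument exists and is continuous in $x$ whenever $x \ne y$. If $s$ is continuous and $r(y) = y\, s(y)$ for $y \in I$,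 then $S$ is consistent for the functional $T$ relative to the class of the compactly supported probability measures on $I$ if, and only if, it is of the form $(\ast)$, where $\phi$ is a convex function on $I$ with subgradient $\phi'$.
   Context: $Y$ denotes a random variable with distribution $F$. A scoring function is a map $S : I \times I \to [0,\infty)$ (point forecast $x$ first, observation $y$ second), measurable in the second argument. For a class $\mathcal{F}$ of probability measures on $I$ and a functional $T : \mathcal{F} \to I$, a function $S$ on $I \times I$ is consistent for $T$ relative to $\mathcal{F}$ if $$\mathbb{E}_F S(T(F),Y) \le \mathbb{E}_F S(x,Y) \quad \text{for all } F \in \mathcal{F} \text{ and all } x \in I.$$ It is strictly consistent if it is consistent and equality in this inequality implies that $x = T(F)$. In part (b) these inequalities are understood for the real-valued function $S$. The functional $T$ is elicitable relative to $\mathcal{F}$ if there exists a scoring function (with values in $[0,\infty)$) that is strictly consistent for $T$ relative to $\mathcal{F}$. "$\phi$ is a convex function with subgradient $\phi'$" means that $\phi : I \to \mathbb{R}$ is convex and $\phi' : I \to \mathbb{R}$ satisfies $\phi(y) \ge \phi(x) + \phi'(x)(y - x)$ for all $x, y \in I$. "Compactly supported probability measures on $I$" are those supported in a compact subset of $I$. *)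

theory Defs
  imports "HOL-Probability.Probability"
begin

text \<open>Functions on an interval \<open>I\<close> are total functions on \<^typ>\<open>real\<close>; only their values on \<open>I\<close> matter.
  A probability measure on \<open>I\<close> lives on the Borel sigma-algebra of the subspace \<open>I\<close>, so that its
  space is \<open>I\<close> itself and integrals with respect to it range over \<open>I\<close>.\<close>

definition prob_measures_on :: "real set \<Rightarrow> real measure set" where
  "prob_measures_on I = {F. prob_space F \<and> sets F = sets (restrict_space borel I)}"

definition compactly_supported_on :: "real set \<Rightarrow> real measure set" where
  "compactly_supported_on I =
     {F \<in> prob_measures_on I. \<exists>K. compact K \<and> K \<subseteq> I \<and> measure F K = 1}"

text \<open>The extended expectation: expectation of the positive part minus that of the negative part
  (\<^const>\<open>ennreal\<close> truncates negative reals to 0). It is \<open>\<infinity>\<close> for nonnegative integrands of infinite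
  expectation and agrees with the Bochner integral on integrable functions. The indeterminate case
  \<open>\<infinity> - \<infinity>\<close> can occur neither for nonnegative nor for integrable functions.\<close>

definition expect :: "real measure \<Rightarrow> (real \<Rightarrow> real) \<Rightarrow> ereal" where
  "expect F f = enn2ereal (\<integral>\<^sup>+y. ennreal (f y) \<partial>F) - enn2ereal (\<integral>\<^sup>+y. ennreal (- f y) \<partial>F)"

definition scoring_function :: "real set \<Rightarrow> (real \<Rightarrow> real \<Rightarrow> real) \<Rightarrow> bool" where
  "scoring_function I S \<longleftrightarrow>
     (\<forall>x\<in>I. \<forall>y\<in>I. 0 \<le> S x y) \<and>
     (\<forall>x\<in>I. S x \<in> borel_measurable (restrict_space borel I))"

definition consistent ::
  "real set \<Rightarrow> real measure set \<Rightarrow> (real measure \<Rightarrow> real) \<Rightarrow> (real \<Rightarrow> real \<Rightarrow> real) \<Rightarrow> bool" where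
  "consistent I \<F> T S \<longleftrightarrow> (\<forall>F\<in>\<F>. \<forall>x\<in>I. expect F (S (T F)) \<le> expect F (S x))"

definition strictly_consistent ::
  "real set \<Rightarrow> real measure set \<Rightarrow> (real measure \<Rightarrow> real) \<Rightarrow> (real \<Rightarrow> real \<Rightarrow> real) \<Rightarrow> bool" where
  "strictly_consistent I \<F> T S \<longleftrightarrow> consistent I \<F> T S \<and>
     (\<forall>F\<in>\<F>. \<forall>x\<in>I. expect F (S (T F)) = expect F (S x) \<longrightarrow> x = T F)"

definition elicitable :: "real set \<Rightarrow> real measure set \<Rightarrow> (real measure \<Rightarrow> real) \<Rightarrow> bool" where
  "elicitable I \<F> T \<longleftrightarrow> (\<exists>S. scoring_function I S \<and> strictly_consistent I \<F> T S)"

definition ratio_functional :: "(real \<Rightarrow> real) \<Rightarrow> (real \<Rightarrow> real) \<Rightarrow> real measure \<Rightarrow> real" where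
  "ratio_functional r s F = (\<integral>y. r y \<partial>F) / (\<integral>y. s y \<partial>F)"

definition strictly_convex_on :: "real set \<Rightarrow> (real \<Rightarrow> real) \<Rightarrow> bool" where
  "strictly_convex_on I \<phi> \<longleftrightarrow> convex I \<and>
     (\<forall>x\<in>I. \<forall>y\<in>I. \<forall>u>0. \<forall>v>0. x \<noteq> y \<and> u + v = 1 \<longrightarrow>
        \<phi> (u * x + v * y) < u * \<phi> x + v * \<phi> y)"

definition subgradient_on :: "real set \<Rightarrow> (real \<Rightarrow> real) \<Rightarrow> (real \<Rightarrow> real) \<Rightarrow> bool" where
  "subgradient_on I \<phi> \<phi>' \<longleftrightarrow> (\<forall>x\<in>I. \<forall>y\<in>I. \<phi> y \<ge> \<phi> x + \<phi>' x * (y - x))"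

definition ratio_score_form ::
  "real set \<Rightarrow> (real \<Rightarrow> real) \<Rightarrow> (real \<Rightarrow> real) \<Rightarrow> (real \<Rightarrow> real) \<Rightarrow> (real \<Rightarrow> real) \<Rightarrow>
     (real \<Rightarrow> real \<Rightarrow> real) \<Rightarrow> bool" where
  "ratio_score_form I r s \<phi> \<phi>' S \<longleftrightarrow> (\<forall>x\<in>I. \<forall>y\<in>I.
     S x y = s y * (\<phi> y - \<phi> x) - \<phi>' x * (r y - x * s y) + \<phi>' y * (r y - y * s y))"

definition ratio_class :: "real set \<Rightarrow> (real \<Rightarrow> real) \<Rightarrow> (real \<Rightarrow> real) \<Rightarrow> real measure set" where
  "ratio_class I r s = {F \<in> prob_measures_on I.
     integrable F r \<and> integrable F s \<and> integrable F (\<lambda>y. y * s y)}"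

definition ratio_score_class ::
  "real set \<Rightarrow> (real \<Rightarrow> real) \<Rightarrow> (real \<Rightarrow> real) \<Rightarrow> (real \<Rightarrow> real) \<Rightarrow> (real \<Rightarrow> real) \<Rightarrow>
     real measure set" where
  "ratio_score_class I r s \<phi> \<phi>' = {F \<in> prob_measures_on I.
     integrable F r \<and> integrable F s \<and> integrable F (\<lambda>y. r y * \<phi>' y) \<and>
     integrable F (\<lambda>y. s y * \<phi> y) \<and> integrable F (\<lambda>y. y * s y * \<phi>' y)}"

definition S0 :: "real set \<Rightarrow> (real \<Rightarrow> real \<Rightarrow> real) \<Rightarrow> bool" where
  "S0 I S \<longleftrightarrow> (\<forall>x\<in>I. \<forall>y\<in>I. 0 \<le> S x y \<and> (x = y \<longrightarrow> S x y = 0))"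

definition S1 :: "real set \<Rightarrow> (real \<Rightarrow> real \<Rightarrow> real) \<Rightarrow> bool" where
  "S1 I S \<longleftrightarrow> (\<forall>y\<in>I. continuous_on I (\<lambda>x. S x y))"

text \<open>At an endpoint of \<open>I\<close> that belongs to \<open>I\<close> the partial derivative is one-sided.\<close>

definition S2 :: "real set \<Rightarrow> (real \<Rightarrow> real \<Rightarrow> real) \<Rightarrow> bool" where
  "S2 I S \<longleftrightarrow> (\<exists>D. \<forall>y\<in>I.
     (\<forall>x\<in>I - {y}. ((\<lambda>u. S u y) has_real_derivative D x y) (at x within I)) \<and>
     continuous_on (I - {y}) (\<lambda>x. D x y))"

end

theory Submission
  imports Defs
begin

text \<open>
  Write \<open>T\<close> for the ratio functional. Scores of the form \<open>c(y) - \<phi>(x) s(y) - \<phi>'(x) (r(y) - x s(y))\<close>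
  have expectation \<open>E c - E s * (\<phi>(x) + \<phi>'(x) (T F - x))\<close>: up to the positive factor \<open>E s\<close> and a
  term without \<open>x\<close>, the forecaster sees the value at \<open>T F\<close> of the supporting line of \<open>\<phi>\<close> at \<open>x\<close>,
  with a minus sign. This value is at most \<open>\<phi>(T F)\<close> and attains it at \<open>x = T F\<close>, only there
  if \<open>\<phi>\<close> is strictly convex. Every sufficiency claim follows from this
  (\<open>tangent_score_consistent\<close>); the three uses differ in the choice of \<open>c\<close> and in
  why \<open>c\<close> is integrable. For elicitability, \<open>\<phi>(x) = sqrt (1 + x\<^sup>2)\<close> grows linearly, and
  \<open>c(y) = s(y) \<phi>(r(y) / s(y)) = sqrt (s(y)\<^sup>2 + r(y)\<^sup>2)\<close> is integrable as soon as \<open>r\<close> and \<open>s\<close> are;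
  this \<open>c\<close> also makes the score nonnegative.

  For the converse, with \<open>r(y) = y s(y)\<close>, let \<open>V(x, y) = S(x, y) / s(y)\<close>. Reweighting by \<open>s\<close> turns
  a two-point measure into one with arbitrary positive weights, so \<open>V\<close> is consistent for the mean on
  two-point measures. Where such a mean \<open>x\<close> lies strictly between the atoms, the first-order
  condition forces \<open>\<partial>V/\<partial>x (x, y) = h(x) (x - y)\<close> with \<open>h\<close> independent of \<open>y\<close>
  (Osband's principle). The usual next step is to integrate \<open>h\<close> twice, which is delicate because \<open>h\<close>
  need not be bounded near an endpoint of \<open>I\<close>. Here no integration takes place: for fixed
  \<open>a\<close>, \<open>b\<close>, \<open>c\<close> the combination \<open>(c - b) V(x, a) + (a - c) V(x, b) + (b - a) V(x, c)\<close> is continuous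
  in \<open>x\<close> and has derivative zero off a finite set, hence is constant
  (\<open>mean_consistent_combination_constant\<close>). This means that \<open>V(x, y) - V(z, y)\<close> is affine in \<open>y\<close>, so
  that \<open>\<phi>(y) = V(z, y)\<close> for any one \<open>z\<close> is the required function and \<open>- \<phi>'(x)\<close> is the slope of
  that difference. Convexity is then nothing but \<open>V \<ge> 0\<close>.
\<close>

section \<open>Expectations under measures on \<open>I\<close>\<close>

lemma expect_eq_integral:
  fixes f :: "real \<Rightarrow> real"
  assumes "integrable F f"
  shows "expect F f = ereal (\<integral>y. f y \<partial>F)"
proof -
  have p: "(\<integral>\<^sup>+y. ennreal (f y) \<partial>F) \<noteq> \<infinity>" and n: "(\<integral>\<^sup>+y. ennreal (- f y) \<partial>F) \<noteq> \<infinity>"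
    using assms by (auto simp: real_integrable_def)
  have e: "enn2ereal a = ereal (enn2real a)" if "a \<noteq> \<infinity>" for a
    using that by (cases a) auto
  show ?thesis
    using real_lebesgue_integral_def[OF assms] e[OF p] e[OF n] by (simp add: expect_def)
qed

lemma space_prob_measures_on: "F \<in> prob_measures_on I \<Longrightarrow> space F = I"
  using sets_eq_imp_space_eq[of F "restrict_space borel I"]
  by (auto simp: prob_measures_on_def space_restrict_space)

lemma measurable_prob_measures_on:
  "F \<in> prob_measures_on I \<Longrightarrow> f \<in> borel_measurable (restrict_space borel I) \<Longrightarrow> f \<in> borel_measurable F"
  using measurable_cong_sets[of F "restrict_space borel I" borel borel]
  by (auto simp: prob_measures_on_def)

lemma integral_pos_prob_measures_on:
  fixes s :: "real \<Rightarrow> real"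
  assumes F: "F \<in> prob_measures_on I" and s: "integrable F s" and pos: "\<forall>y\<in>I. 0 < s y"
  shows "0 < (\<integral>y. s y \<partial>F)"
proof -
  interpret prob_space F using F by (auto simp: prob_measures_on_def)
  have pos': "0 < s y" if "y \<in> space F" for y
    using that pos space_prob_measures_on[OF F] by auto
  have "(\<integral>y. s y \<partial>F) \<noteq> 0"
  proof
    assume "(\<integral>y. s y \<partial>F) = 0"
    then have "AE y in F. s y = 0"
      using integral_nonneg_eq_0_iff_AE[OF s AE_I2] pos' less_imp_le by metis
    then have "AE y in F. False"
      by (rule AE_mp) (rule AE_I2, use pos' in force)
    then show False by simp
  qed
  moreover have "0 \<le> (\<integral>y. s y \<partial>F)"
    by (rule integral_nonneg_AE) (use pos' in \<open>auto simp: less_imp_le\<close>)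
  ultimately show ?thesis by simp
qed

section \<open>Scores built from supporting lines\<close>

definition tangent :: "(real \<Rightarrow> real) \<Rightarrow> (real \<Rightarrow> real) \<Rightarrow> real \<Rightarrow> real \<Rightarrow> real" where
  "tangent \<phi> \<phi>' x t = \<phi> x + \<phi>' x * (t - x)"

text \<open>The expectation is affine in \<open>(E r, E s)\<close>, and dividing by \<open>E s > 0\<close> exhibits the tangent at
  \<open>x\<close>, evaluated at the ratio. The score enters only through its values on \<open>I = space F\<close>.\<close>

lemma expect_tangent_score:
  assumes F: "F \<in> prob_measures_on I" and pos: "\<forall>y\<in>I. 0 < s y"
    and int: "integrable F r" "integrable F s" "integrable F c"
    and S: "\<forall>y\<in>I. S x y = c y - \<phi> x * s y - \<phi>' x * (r y - x * s y)"
  shows "expect F (S x) =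
    ereal ((\<integral>y. c y \<partial>F) - (\<integral>y. s y \<partial>F) * tangent \<phi> \<phi>' x (ratio_functional r s F))"
proof -
  let ?g = "\<lambda>y. c y - \<phi> x * s y - \<phi>' x * (r y - x * s y)"
  have g: "integrable F ?g" using int by simp
  have eq: "S x y = ?g y" if "y \<in> space F" for y
    using that S space_prob_measures_on[OF F] by auto
  have "integrable F (S x)" using g eq Bochner_Integration.integrable_cong[of F F "S x" ?g] by auto
  then have "expect F (S x) = ereal (\<integral>y. S x y \<partial>F)" by (rule expect_eq_integral)
  also have "(\<integral>y. S x y \<partial>F) = (\<integral>y. ?g y \<partial>F)"
    using eq by (intro Bochner_Integration.integral_cong) auto
  also have "\<dots> = (\<integral>y. c y \<partial>F) - \<phi> x * (\<integral>y. s y \<partial>F)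
      - \<phi>' x * ((\<integral>y. r y \<partial>F) - x * (\<integral>y. s y \<partial>F))"
    using int by simp
  also have "\<dots> = (\<integral>y. c y \<partial>F) - (\<integral>y. s y \<partial>F) * tangent \<phi> \<phi>' x (ratio_functional r s F)"
    using integral_pos_prob_measures_on[OF F int(2) pos]
    by (simp add: ratio_functional_def tangent_def field_simps)
  finally show ?thesis .
qed

text \<open>Consistency is the statement that tangents lie below \<open>\<phi>\<close>, and strict consistency that they touch
  it at one point only. The latter is assumed in this form, rather than as strict convexity, because
  for a concrete \<open>\<phi>\<close> it can be computed.\<close>

lemma tangent_score_consistent:
  assumes pos: "\<forall>y\<in>I. 0 < s y"
    and mem: "\<And>F. F \<in> \<F> \<Longrightarrow> F \<in> prob_measures_on I \<and>
        integrable F r \<and> integrable F s \<and> integrable F c \<and> ratio_functional r s F \<in> I"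
    and S: "\<forall>x\<in>I. \<forall>y\<in>I. S x y = c y - \<phi> x * s y - \<phi>' x * (r y - x * s y)"
    and sub: "subgradient_on I \<phi> \<phi>'"
  shows "consistent I \<F> (ratio_functional r s) S"
    and "(\<forall>x\<in>I. \<forall>t\<in>I. x \<noteq> t \<longrightarrow> tangent \<phi> \<phi>' x t < \<phi> t) \<Longrightarrow>
      strictly_consistent I \<F> (ratio_functional r s) S"
proof -
  have E: "expect F (S x) =
      ereal ((\<integral>y. c y \<partial>F) - (\<integral>y. s y \<partial>F) * tangent \<phi> \<phi>' x (ratio_functional r s F))"
    if "F \<in> \<F>" "x \<in> I" for F x
    using mem[OF that(1)] S that(2) pos by (intro expect_tangent_score) auto
  have diag: "tangent \<phi> \<phi>' t t = \<phi> t" for t by (simp add: tangent_def)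
  show c: "consistent I \<F> (ratio_functional r s) S"
    unfolding consistent_def
  proof (intro ballI)
    fix F x assume F: "F \<in> \<F>" and x: "x \<in> I"
    let ?t = "ratio_functional r s F"
    have t: "?t \<in> I" using mem[OF F] by simp
    have "tangent \<phi> \<phi>' x ?t \<le> \<phi> ?t"
      using sub x t by (auto simp: subgradient_on_def tangent_def)
    moreover have "0 < (\<integral>y. s y \<partial>F)"
      using mem[OF F] pos by (blast intro: integral_pos_prob_measures_on)
    ultimately show "expect F (S ?t) \<le> expect F (S x)"
      using E[OF F x] E[OF F t] diag by simp
  qed
  show "strictly_consistent I \<F> (ratio_functional r s) S"
    if strict: "\<forall>x\<in>I. \<forall>t\<in>I. x \<noteq> t \<longrightarrow> tangent \<phi> \<phi>' x t < \<phi> t"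
    unfolding strictly_consistent_def
  proof (intro conjI c ballI impI)
    fix F x assume F: "F \<in> \<F>" and x: "x \<in> I"
    let ?t = "ratio_functional r s F"
    assume eq: "expect F (S ?t) = expect F (S x)"
    have t: "?t \<in> I" using mem[OF F] by simp
    have "0 < (\<integral>y. s y \<partial>F)"
      using mem[OF F] pos by (blast intro: integral_pos_prob_measures_on)
    then have "tangent \<phi> \<phi>' x ?t = \<phi> ?t"
      using eq E[OF F x] E[OF F t] diag by simp
    then show "x = ?t" using strict x t by fastforce
  qed
qed

text \<open>If the tangent at \<open>x\<close> met the graph again at \<open>t\<close>, then at the midpoint it would coincide with the
  chord and lie above \<open>\<phi>\<close>.\<close>

lemma tangent_less_if_strictly_convex:
  assumes cvx: "strictly_convex_on I \<phi>" and sub: "subgradient_on I \<phi> \<phi>'"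
    and x: "x \<in> I" and t: "t \<in> I" and ne: "x \<noteq> t"
  shows "tangent \<phi> \<phi>' x t < \<phi> t"
proof -
  let ?m = "(1/2) * x + (1/2) * t"
  have "convex I" using cvx by (simp add: strictly_convex_on_def)
  then have m: "?m \<in> I" using convexD[of I x t "1/2" "1/2"] x t by simp
  have "0 < (1/2::real)" "(1/2::real) + 1/2 = 1" by simp_all
  then have "\<phi> ?m < (1/2) * \<phi> x + (1/2) * \<phi> t"
    using cvx x t ne unfolding strictly_convex_on_def by blast
  moreover have "\<phi> x + \<phi>' x * (?m - x) \<le> \<phi> ?m"
    using sub x m unfolding subgradient_on_def by blast
  ultimately show ?thesis by (simp add: tangent_def algebra_simps)
qed

section \<open>Elicitability\<close>

text \<open>The tangent at \<open>x\<close> takes the value \<open>(1 + x t) / sqrt (1 + x\<^sup>2)\<close> at \<open>t\<close>, so this is the Cauchy--Schwarz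
  inequality for \<open>(1, x)\<close> and \<open>(1, t)\<close>, strict because these vectors are not parallel.\<close>

lemma tangent_hyperbola_less:
  fixes x t :: real
  assumes "x \<noteq> t"
  shows "tangent (\<lambda>x. sqrt (1 + x\<^sup>2)) (\<lambda>x. x / sqrt (1 + x\<^sup>2)) x t < sqrt (1 + t\<^sup>2)"
proof -
  have p: "0 < 1 + x\<^sup>2" by (smt (verit) zero_le_power2)
  have "0 < (x - t)\<^sup>2" using assms by simp
  then have "(1 + x * t)\<^sup>2 < (1 + t\<^sup>2) * (1 + x\<^sup>2)"
    by (simp add: power2_eq_square algebra_simps)
  then have "1 + x * t < sqrt ((1 + t\<^sup>2) * (1 + x\<^sup>2))" by (rule real_less_rsqrt)
  then have "1 + x * t < sqrt (1 + t\<^sup>2) * sqrt (1 + x\<^sup>2)" by (simp add: real_sqrt_mult)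
  then have "(1 + x * t) / sqrt (1 + x\<^sup>2) < sqrt (1 + t\<^sup>2)"
    using p by (simp add: pos_divide_less_eq)
  moreover have "sqrt (1 + x\<^sup>2) = (1 + x\<^sup>2) / sqrt (1 + x\<^sup>2)"
    using p by (simp add: real_div_sqrt)
  then have "tangent (\<lambda>x. sqrt (1 + x\<^sup>2)) (\<lambda>x. x / sqrt (1 + x\<^sup>2)) x t
      = (1 + x\<^sup>2) / sqrt (1 + x\<^sup>2) + x / sqrt (1 + x\<^sup>2) * (t - x)"
    by (simp add: tangent_def)
  then have "tangent (\<lambda>x. sqrt (1 + x\<^sup>2)) (\<lambda>x. x / sqrt (1 + x\<^sup>2)) x t = (1 + x * t) / sqrt (1 + x\<^sup>2)"
    by (simp add: add_divide_distrib[symmetric] power2_eq_square algebra_simps)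
  ultimately show ?thesis by simp
qed

text \<open>With \<open>c = sqrt (s\<^sup>2 + r\<^sup>2)\<close> the score at \<open>y\<close> is \<open>s(y)\<close> times the gap between \<open>\<phi>\<close> and its tangent at \<open>x\<close>,
  evaluated at \<open>r(y) / s(y)\<close>. Since \<open>\<phi>\<close> is convex on all of \<open>\<real>\<close>, the score is nonnegative wherever
  this quotient lies.\<close>

lemma ratio_elicitable:
  fixes r s :: "real \<Rightarrow> real"
  assumes r: "r \<in> borel_measurable (restrict_space borel I)"
    and s: "s \<in> borel_measurable (restrict_space borel I)"
    and pos: "\<forall>y\<in>I. 0 < s y"
    and T: "\<forall>F\<in>ratio_class I r s. ratio_functional r s F \<in> I"
  shows "elicitable I (ratio_class I r s) (ratio_functional r s)"
proof -
  let ?\<phi> = "\<lambda>x::real. sqrt (1 + x\<^sup>2)" and ?\<phi>' = "\<lambda>x::real. x / sqrt (1 + x\<^sup>2)"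
  let ?c = "\<lambda>y. sqrt ((s y)\<^sup>2 + (r y)\<^sup>2)"
  define S where "S x y = ?c y - ?\<phi> x * s y - ?\<phi>' x * (r y - x * s y)" for x y
  have le: "tangent ?\<phi> ?\<phi>' x t \<le> ?\<phi> t" for x t
    using tangent_hyperbola_less[of x t] by (cases "x = t") (auto simp: tangent_def)
  have nonneg: "0 \<le> S x y" if y: "y \<in> I" for x y
  proof -
    have sy: "0 < s y" using pos y by simp
    have "?c y = s y * ?\<phi> (r y / s y)"
    proof -
      have "(s y)\<^sup>2 + (r y)\<^sup>2 = (s y)\<^sup>2 * (1 + (r y / s y)\<^sup>2)"
        using sy by (simp add: field_simps)
      then show ?thesis using sy by (simp add: real_sqrt_mult)
    qed
    then have "S x y = s y * (?\<phi> (r y / s y) - tangent ?\<phi> ?\<phi>' x (r y / s y))"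
      using sy by (simp add: S_def tangent_def right_diff_distrib distrib_left mult.commute)
    then show ?thesis using le[of x "r y / s y"] sy by simp
  qed
  have "scoring_function I S"
    unfolding scoring_function_def
  proof (intro conjI ballI)
    show "0 \<le> S x y" if "x \<in> I" "y \<in> I" for x y using nonneg that by blast
    show "S x \<in> borel_measurable (restrict_space borel I)" for x
      unfolding S_def using r s by measurable
  qed
  moreover have "strictly_consistent I (ratio_class I r s) (ratio_functional r s) S"
  proof (rule tangent_score_consistent(2)[OF pos])
    fix F assume F: "F \<in> ratio_class I r s"
    then have P: "F \<in> prob_measures_on I" and int: "integrable F r" "integrable F s"
      by (auto simp: ratio_class_def)
    have "integrable F ?c"
    proof (rule Bochner_Integration.integrable_bound)
      show "integrable F (\<lambda>y. \<bar>s y\<bar> + \<bar>r y\<bar>)" using int by simp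
      show "?c \<in> borel_measurable F" using int by measurable
      show "AE y in F. norm (?c y) \<le> norm (\<bar>s y\<bar> + \<bar>r y\<bar>)"
        by (simp add: sqrt_sum_squares_le_sum_abs)
    qed
    then show "F \<in> prob_measures_on I \<and> integrable F r \<and> integrable F s \<and> integrable F ?c \<and>
        ratio_functional r s F \<in> I"
      using P int T F by blast
  next
    show "\<forall>x\<in>I. \<forall>y\<in>I. S x y = ?c y - ?\<phi> x * s y - ?\<phi>' x * (r y - x * s y)"
      by (simp add: S_def)
    show "subgradient_on I ?\<phi> ?\<phi>'"
      using le by (auto simp: subgradient_on_def tangent_def)
    show "\<forall>x\<in>I. \<forall>t\<in>I. x \<noteq> t \<longrightarrow> tangent ?\<phi> ?\<phi>' x t < ?\<phi> t"
      using tangent_hyperbola_less by blast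
  qed
  ultimately show ?thesis unfolding elicitable_def by blast
qed

section \<open>Consistency of the scores \<open>(\<ast>)\<close>\<close>

text \<open>The moment conditions of the class are what makes \<open>c = s \<phi> + r \<phi>' - y s \<phi>'\<close> integrable.\<close>

lemma ratio_score_consistent:
  assumes pos: "\<forall>y\<in>I. 0 < s y"
    and sub: "subgradient_on I \<phi> \<phi>'" and form: "ratio_score_form I r s \<phi> \<phi>' S"
    and T: "\<forall>F\<in>ratio_score_class I r s \<phi> \<phi>'. ratio_functional r s F \<in> I"
  shows "consistent I (ratio_score_class I r s \<phi> \<phi>') (ratio_functional r s) S"
    and "strictly_convex_on I \<phi> \<Longrightarrow>
      strictly_consistent I (ratio_score_class I r s \<phi> \<phi>') (ratio_functional r s) S"
proof -
  let ?c = "\<lambda>y. s y * \<phi> y + (r y * \<phi>' y - y * s y * \<phi>' y)"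
  have mem: "F \<in> prob_measures_on I \<and> integrable F r \<and> integrable F s \<and> integrable F ?c \<and>
      ratio_functional r s F \<in> I" if "F \<in> ratio_score_class I r s \<phi> \<phi>'" for F
    using that T by (auto simp: ratio_score_class_def)
  have S: "\<forall>x\<in>I. \<forall>y\<in>I. S x y = ?c y - \<phi> x * s y - \<phi>' x * (r y - x * s y)"
    using form by (auto simp: ratio_score_form_def algebra_simps)
  show "consistent I (ratio_score_class I r s \<phi> \<phi>') (ratio_functional r s) S"
    using tangent_score_consistent(1)[OF pos mem S sub] by blast
  show "strictly_consistent I (ratio_score_class I r s \<phi> \<phi>') (ratio_functional r s) S"
    if "strictly_convex_on I \<phi>"
    using tangent_score_consistent(2)[OF pos mem S sub]
      tangent_less_if_strictly_convex[OF that sub] by blast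
qed

text \<open>The tangent at the convex combination minorizes \<open>\<phi>\<close> at both points; averaging the two
  inequalities cancels the slope.\<close>

lemma subgradient_imp_convex_on:
  assumes I: "convex I" and sub: "subgradient_on I \<phi> \<phi>'"
  shows "convex_on I \<phi>"
  unfolding convex_on_def
proof (intro conjI I ballI allI impI)
  fix x y u v :: real
  assume x: "x \<in> I" and y: "y \<in> I" and u: "0 \<le> u" and v: "0 \<le> v" and uv: "u + v = 1"
  let ?z = "u *\<^sub>R x + v *\<^sub>R y"
  have z: "?z \<in> I" using convexD[OF I x y u v uv] .
  have "u * (\<phi> ?z + \<phi>' ?z * (x - ?z)) + v * (\<phi> ?z + \<phi>' ?z * (y - ?z)) \<le> u * \<phi> x + v * \<phi> y"
    using sub z x y u v by (intro add_mono mult_left_mono) (auto simp: subgradient_on_def)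
  moreover have "u * (\<phi> ?z + \<phi>' ?z * (x - ?z)) + v * (\<phi> ?z + \<phi>' ?z * (y - ?z))
      = (u + v) * \<phi> ?z + \<phi>' ?z * (?z - (u + v) * ?z)"
    by (simp add: algebra_simps)
  ultimately show "\<phi> ?z \<le> u * \<phi> x + v * \<phi> y" by (simp add: uv)
qed

text \<open>On \<open>K\<close>, the function \<open>\<phi>\<close> lies above its tangent at the least point of \<open>K\<close>, and below
  its value at the least or at the greatest point of \<open>K\<close>, according to the sign of the slope at the
  point considered.\<close>

lemma subgradient_bounded_on_compact:
  assumes K: "compact K" "K \<subseteq> I" and sub: "subgradient_on I \<phi> \<phi>'"
  obtains B where "\<And>y. y \<in> K \<Longrightarrow> \<bar>\<phi> y\<bar> \<le> B"
proof (cases "K = {}")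
  case True
  then show ?thesis using that by blast
next
  case False
  obtain a where a: "a \<in> K" "\<forall>y\<in>K. a \<le> y" using compact_attains_inf[OF K(1) False] by blast
  obtain b where b: "b \<in> K" "\<forall>y\<in>K. y \<le> b" using compact_attains_sup[OF K(1) False] by blast
  have "\<bar>\<phi> y\<bar> \<le> \<bar>\<phi> a\<bar> + \<bar>\<phi> b\<bar> + \<bar>\<phi>' a\<bar> * (b - a)" if y: "y \<in> K" for y
  proof -
    have ay: "a \<le> y" and yb: "y \<le> b" using a b y by auto
    have la: "\<phi> a + \<phi>' a * (y - a) \<le> \<phi> y"
      and uz: "\<phi> y + \<phi>' y * (a - y) \<le> \<phi> a" "\<phi> y + \<phi>' y * (b - y) \<le> \<phi> b"
      using sub y a(1) b(1) K(2) unfolding subgradient_on_def by blast+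
    have "\<bar>\<phi>' a * (y - a)\<bar> \<le> \<bar>\<phi>' a\<bar> * (b - a)"
      using ay yb by (auto simp: abs_mult intro!: mult_left_mono)
    moreover have "\<phi> y \<le> \<phi> a \<or> \<phi> y \<le> \<phi> b"
    proof (cases "0 \<le> \<phi>' y")
      case True
      then have "0 \<le> \<phi>' y * (b - y)" using yb by simp
      then show ?thesis using uz by linarith
    next
      case False
      then have "0 \<le> \<phi>' y * (a - y)" using ay by (simp add: mult_nonpos_nonpos)
      then show ?thesis using uz by linarith
    qed
    ultimately show ?thesis using la by linarith
  qed
  then show ?thesis using that by blast
qed

lemma integrable_compactly_supported:
  fixes f :: "real \<Rightarrow> real"
  assumes F: "F \<in> prob_measures_on I" and K: "K \<in> sets F" "measure F K = 1"
    and f: "f \<in> borel_measurable (restrict_space borel I)"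
    and bound: "\<And>y. y \<in> K \<Longrightarrow> \<bar>f y\<bar> \<le> B"
  shows "integrable F f"
proof -
  interpret prob_space F using F by (simp add: prob_measures_on_def)
  have "AE y in F. y \<in> K" using K prob_eq_1 by simp
  then show ?thesis
    using bound by (intro integrable_const_bound[where B = B] measurable_prob_measures_on[OF F f]) auto
qed

lemma continuous_bounded_on_compact:
  fixes f :: "real \<Rightarrow> real"
  assumes "compact K" "continuous_on K f"
  obtains B where "\<And>y. y \<in> K \<Longrightarrow> \<bar>f y\<bar> \<le> B"
  using compact_imp_bounded[OF compact_continuous_image[OF assms(2,1)]]
  by (auto simp: bounded_iff)

text \<open>When \<open>r(y) = y s(y)\<close>, the terms with \<open>\<phi>'(y)\<close> cancel in \<open>(\<ast>)\<close> and only \<open>c = s \<phi>\<close> has to be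
  integrable: it is bounded on the compact support.\<close>

lemma ratio_score_consistent_compactly_supported:
  assumes meas: "r \<in> borel_measurable (restrict_space borel I)"
      "s \<in> borel_measurable (restrict_space borel I)"
    and pos: "\<forall>y\<in>I. 0 < s y" and cont: "continuous_on I s" and r: "\<forall>y\<in>I. r y = y * s y"
    and T: "\<forall>F\<in>compactly_supported_on I. ratio_functional r s F \<in> I"
    and score: "scoring_function I S"
    and sub: "subgradient_on I \<phi> \<phi>'" and form: "ratio_score_form I r s \<phi> \<phi>' S"
  shows "consistent I (compactly_supported_on I) (ratio_functional r s) S"
proof -
  let ?c = "\<lambda>y. s y * \<phi> y"
  have S: "\<forall>x\<in>I. \<forall>y\<in>I. S x y = ?c y - \<phi> x * s y - \<phi>' x * (r y - x * s y)"
    using form r by (simp add: ratio_score_form_def algebra_simps)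
  show ?thesis
  proof (rule tangent_score_consistent(1)[OF pos _ S sub])
    fix F assume cF: "F \<in> compactly_supported_on I"
    then obtain K where F: "F \<in> prob_measures_on I" and K: "compact K" "K \<subseteq> I" "measure F K = 1"
      by (auto simp: compactly_supported_on_def)
    have KF: "K \<in> sets F"
      using K(3) measure_notin_sets[of K F] by fastforce
    have tI: "ratio_functional r s F \<in> I" using T cF by blast
    let ?t = "ratio_functional r s F"
    \<comment> \<open>Solving \<open>(\<ast>)\<close> for \<open>c\<close> transfers the measurability of the score at one forecast to \<open>c\<close>.\<close>
    have "(\<lambda>y. S ?t y + \<phi> ?t * s y + \<phi>' ?t * (r y - ?t * s y)) \<in> borel_measurable (restrict_space borel I)"
      using score tI meas unfolding scoring_function_def
      by (intro borel_measurable_add borel_measurable_diff borel_measurable_times borel_measurable_const) auto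
    also have "?this \<longleftrightarrow> ?c \<in> borel_measurable (restrict_space borel I)"
      by (rule measurable_cong) (use S tI in \<open>auto simp: space_restrict_space\<close>)
    finally have mc: "?c \<in> borel_measurable (restrict_space borel I)" .
    have sK: "continuous_on K s" using cont K(2) continuous_on_subset by blast
    obtain Bs where Bs: "\<And>y. y \<in> K \<Longrightarrow> \<bar>s y\<bar> \<le> Bs"
      using continuous_bounded_on_compact[OF K(1) sK] by blast
    have "continuous_on K (\<lambda>y. y * s y)" using sK by (intro continuous_intros)
    then obtain Br where Br: "\<And>y. y \<in> K \<Longrightarrow> \<bar>y * s y\<bar> \<le> Br"
      using continuous_bounded_on_compact[OF K(1)] by blast
    obtain B where B: "\<And>y. y \<in> K \<Longrightarrow> \<bar>\<phi> y\<bar> \<le> B"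
      using subgradient_bounded_on_compact[OF K(1,2) sub] by blast
    have "\<bar>?c y\<bar> \<le> Bs * B" if "y \<in> K" for y
      using mult_mono[OF Bs[OF that] B[OF that]] Bs[OF that] by (simp add: abs_mult)
    then have "integrable F ?c"
      by (rule integrable_compactly_supported[OF F KF K(3) mc])
    moreover have "integrable F s"
      by (rule integrable_compactly_supported[OF F KF K(3) meas(2) Bs])
    moreover have "integrable F r"
      by (rule integrable_compactly_supported[OF F KF K(3) meas(1), where B = Br]) (use Br r K in auto)
    ultimately show "F \<in> prob_measures_on I \<and> integrable F r \<and> integrable F s \<and> integrable F ?c \<and>
        ratio_functional r s F \<in> I"
      using F tI by blast
  qed
qed

section \<open>Two-point measures\<close>

text \<open>The measure with mass \<open>p\<close> at \<open>a\<close> and \<open>1 - p\<close> at \<open>b\<close>, as the image of a Bernoulli law: this puts it on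
  the Borel sets of \<open>I\<close> rather than on all subsets.\<close>

definition two_point :: "real set \<Rightarrow> real \<Rightarrow> real \<Rightarrow> real \<Rightarrow> real measure" where
  "two_point I p a b =
     distr (measure_pmf (bernoulli_pmf p)) (restrict_space borel I) (\<lambda>t. if t then a else b)"

lemma two_point_measurable:
  assumes "a \<in> I" "b \<in> I"
  shows "(\<lambda>t. if t then a else b) \<in> measurable (measure_pmf (bernoulli_pmf p)) (restrict_space borel I)"
  using assms by (auto simp: space_restrict_space)

lemma integral_two_point:
  fixes f :: "real \<Rightarrow> real"
  assumes ab: "a \<in> I" "b \<in> I" and p: "0 \<le> p" "p \<le> 1"
    and f: "f \<in> borel_measurable (restrict_space borel I)"
  shows "integrable (two_point I p a b) f"
    and "(\<integral>y. f y \<partial>two_point I p a b) = p * f a + (1 - p) * f b"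
proof -
  show "integrable (two_point I p a b) f"
    unfolding two_point_def using integrable_distr_eq[OF two_point_measurable[OF ab] f]
    by (auto intro!: integrable_measure_pmf_finite)
  show "(\<integral>y. f y \<partial>two_point I p a b) = p * f a + (1 - p) * f b"
    unfolding two_point_def using integral_distr[OF two_point_measurable[OF ab] f] p
    by simp
qed

lemma two_point_compactly_supported:
  assumes ab: "a \<in> I" "b \<in> I"
  shows "two_point I p a b \<in> compactly_supported_on I"
proof -
  have K: "{a, b} \<in> sets (restrict_space borel I)"
    using ab by (auto simp: sets_restrict_space intro!: image_eqI[of _ _ "{a, b}"])
  have "(\<lambda>t. if t then a else b) -` {a, b} = UNIV" by auto
  then have "measure (two_point I p a b) {a, b} = 1"
    unfolding two_point_def using measure_distr[OF two_point_measurable[OF ab] K]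
    by simp
  moreover have "prob_space (two_point I p a b)"
    unfolding two_point_def by (rule measure_pmf.prob_space_distr[OF two_point_measurable[OF ab]])
  moreover have "sets (two_point I p a b) = sets (restrict_space borel I)"
    by (simp add: two_point_def)
  ultimately show ?thesis
    using ab unfolding compactly_supported_on_def prob_measures_on_def
    by (auto intro!: exI[of _ "{a, b}"])
qed

text \<open>The masses are proportional to \<open>s(b) (b - m)\<close> at \<open>a\<close> and to \<open>s(a) (m - a)\<close> at \<open>b\<close>. Then the integral of
  \<open>s\<close> weighs \<open>a\<close> and \<open>b\<close> in the ratio \<open>b - m\<close> to \<open>m - a\<close>, so that the functional is \<open>m\<close>, and the
  expected score is a positive multiple of the mean of \<open>S / s\<close> under these weights.\<close>

lemma consistent_two_point:
  assumes meas: "r \<in> borel_measurable (restrict_space borel I)"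
      "s \<in> borel_measurable (restrict_space borel I)"
    and pos: "\<forall>y\<in>I. 0 < s y" and r: "\<forall>y\<in>I. r y = y * s y"
    and score: "scoring_function I S"
    and cons: "consistent I (compactly_supported_on I) (ratio_functional r s) S"
    and a: "a \<in> I" and b: "b \<in> I" and m: "m \<in> I" and x: "x \<in> I" and am: "a < m" and mb: "m < b"
  shows "(b - m) * (S m a / s a) + (m - a) * (S m b / s b)
    \<le> (b - m) * (S x a / s a) + (m - a) * (S x b / s b)"
proof -
  have sa: "0 < s a" and sb: "0 < s b" using pos a b by auto
  define u v where "u = s b * (b - m)" and "v = s a * (m - a)"
  have uv: "0 < u" "0 < v" using sa sb am mb by (auto simp: u_def v_def)
  define p where "p = u / (u + v)"
  have q: "1 - p = v / (u + v)" using uv by (simp add: p_def field_simps)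
  have p: "0 \<le> p" "p \<le> 1" using uv by (auto simp: p_def)
  let ?F = "two_point I p a b"
  note int = integral_two_point[OF a b p]
  have "u * (a * s a) + v * (b * s b) = m * (u * s a + v * s b)"
    by (simp add: u_def v_def algebra_simps)
  moreover have "0 < u * s a + v * s b" using uv sa sb by (simp add: add_pos_pos)
  moreover have "(\<integral>y. r y \<partial>?F) = (u * (a * s a) + v * (b * s b)) / (u + v)"
    using int(2)[OF meas(1)] r a b by (simp add: q) (simp add: p_def add_divide_distrib)
  moreover have "(\<integral>y. s y \<partial>?F) = (u * s a + v * s b) / (u + v)"
    using int(2)[OF meas(2)] by (simp add: q) (simp add: p_def add_divide_distrib)
  ultimately have T: "ratio_functional r s ?F = m"
    using uv by (simp add: ratio_functional_def)
  have E: "expect ?F (S z) = ereal ((u * S z a + v * S z b) / (u + v))" if "z \<in> I" for z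
  proof -
    have z: "S z \<in> borel_measurable (restrict_space borel I)"
      using score that by (simp add: scoring_function_def)
    show ?thesis
      using expect_eq_integral[OF int(1)[OF z]] int(2)[OF z] 
      by (simp add: q) (simp add: p_def add_divide_distrib)
  qed
  have "expect ?F (S m) \<le> expect ?F (S x)"
    using cons two_point_compactly_supported[OF a b] x T unfolding consistent_def by metis
  then have "u * S m a + v * S m b \<le> u * S x a + v * S x b"
    using E[OF m] E[OF x] uv by (simp add: divide_le_cancel)
  then have "(u * S m a + v * S m b) / (s a * s b) \<le> (u * S x a + v * S x b) / (s a * s b)"
    using sa sb by (simp add: divide_right_mono)
  moreover have "(u * S z a + v * S z b) / (s a * s b) = (b - m) * (S z a / s a) + (m - a) * (S z b / s b)" for z
    using sa sb by (simp add: u_def v_def field_simps)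
  ultimately show ?thesis by simp
qed

section \<open>Scores consistent for the mean\<close>

lemma interval_interior_between:
  fixes I :: "real set"
  assumes "is_interval I" "a \<in> I" "b \<in> I" "a < x" "x < b"
  shows "x \<in> interior I"
proof -
  have "{a<..<b} \<subseteq> I" using assms(1-3) unfolding is_interval_1 by (meson greaterThanLessThan_iff less_imp_le subsetI)
  then have "{a<..<b} \<subseteq> interior I" by (simp add: interior_maximal)
  then show ?thesis using assms by auto
qed

text \<open>The score averaged over the two-point measure with mean \<open>x\<close> is minimal at the interior point \<open>x\<close>, so
  its derivative vanishes there.\<close>

lemma mean_consistent_first_order:
  fixes V :: "real \<Rightarrow> real \<Rightarrow> real"
  assumes I: "is_interval I"
    and min: "\<And>a b m x. \<lbrakk>a \<in> I; b \<in> I; m \<in> I; x \<in> I; a < m; m < b\<rbrakk> \<Longrightarrow>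
      (b - m) * V m a + (m - a) * V m b \<le> (b - m) * V x a + (m - a) * V x b"
    and der: "\<And>y x. y \<in> I \<Longrightarrow> x \<in> I \<Longrightarrow> x \<noteq> y \<Longrightarrow>
      ((\<lambda>u. V u y) has_real_derivative D x y) (at x within I)"
    and a: "a \<in> I" and b: "b \<in> I" and x: "x \<in> I" and ax: "a < x" and xb: "x < b"
  shows "(b - x) * D x a + (x - a) * D x b = 0"
proof -
  have int: "x \<in> interior I" using interval_interior_between[OF I a b ax xb] .
  then have at: "at x within I = at x" by (rule at_within_interior)
  have "((\<lambda>u. (b - x) * V u a + (x - a) * V u b) has_real_derivative (b - x) * D x a + (x - a) * D x b) (at x)"
    using der[OF a x] der[OF b x] ax xb at by (auto intro!: derivative_eq_intros)
  moreover obtain d where "0 < d" "ball x d \<subseteq> I" using int mem_interior by blast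
  moreover have "(b - x) * V x a + (x - a) * V x b \<le> (b - x) * V z a + (x - a) * V z b"
    if "\<bar>x - z\<bar> < d" for z
  proof -
    have "z \<in> I" using that \<open>ball x d \<subseteq> I\<close> by (auto simp: dist_real_def)
    then show ?thesis using min[OF a b x _ ax xb] by blast
  qed
  ultimately show ?thesis using DERIV_local_min by blast
qed

text \<open>In the first-order condition for \<open>a < x < b\<close>, dividing by \<open>(b - x) (x - a)\<close> shows that the quotient of
  \<open>D x y\<close> by \<open>x - y\<close> is the same at \<open>a\<close> and at \<open>b\<close>. Hence all points above \<open>x\<close> share the value at \<open>l\<close>, and all
  points below \<open>x\<close> share the value at \<open>u\<close>.\<close>

lemma mean_consistent_derivative:
  fixes V :: "real \<Rightarrow> real \<Rightarrow> real"
  assumes I: "is_interval I"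
    and min: "\<And>a b m x. \<lbrakk>a \<in> I; b \<in> I; m \<in> I; x \<in> I; a < m; m < b\<rbrakk> \<Longrightarrow>
      (b - m) * V m a + (m - a) * V m b \<le> (b - m) * V x a + (m - a) * V x b"
    and der: "\<And>y x. y \<in> I \<Longrightarrow> x \<in> I \<Longrightarrow> x \<noteq> y \<Longrightarrow>
      ((\<lambda>u. V u y) has_real_derivative D x y) (at x within I)"
    and l: "l \<in> I" and u: "u \<in> I" and x: "x \<in> I" and lx: "l < x" and xu: "x < u"
  obtains h where "\<And>y. y \<in> I \<Longrightarrow> y \<noteq> x \<Longrightarrow> D x y = h * (x - y)"
proof -
  have foc: "(b - x) * D x a + (x - a) * D x b = 0"
    if "a \<in> I" "b \<in> I" "a < x" "x < b" for a b
    using mean_consistent_first_order[where V = V and D = D] I min der that x by blast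
  define h where "h = D x l / (x - l)"
  have l': "D x l = h * (x - l)" using lx by (simp add: h_def)
  have up: "D x y = h * (x - y)" if "y \<in> I" "x < y" for y
  proof -
    have "(x - l) * (D x y - h * (x - y)) = 0"
      using foc[OF l that(1) lx that(2)] by (simp add: l' algebra_simps)
    then show ?thesis using lx by simp
  qed
  have "D x y = h * (x - y)" if "y \<in> I" "y \<noteq> x" for y
  proof (cases "x < y")
    case False
    then have yx: "y < x" using that by simp
    have "(u - x) * (D x y - h * (x - y)) = 0"
      using foc[OF that(1) u yx xu] up[OF u xu] by (simp add: algebra_simps)
    then show ?thesis using xu by simp
  qed (use up that in blast)
  then show ?thesis using that by blast
qed

text \<open>The coefficients annihilate affine functions of \<open>y\<close>, in particular \<open>h(x) (x - y)\<close>.\<close>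

lemma mean_consistent_combination_constant:
  fixes V :: "real \<Rightarrow> real \<Rightarrow> real"
  assumes I: "is_interval I"
    and min: "\<And>a b m x. \<lbrakk>a \<in> I; b \<in> I; m \<in> I; x \<in> I; a < m; m < b\<rbrakk> \<Longrightarrow>
      (b - m) * V m a + (m - a) * V m b \<le> (b - m) * V x a + (m - a) * V x b"
    and cont: "\<And>y. y \<in> I \<Longrightarrow> continuous_on I (\<lambda>x. V x y)"
    and der: "\<And>y x. y \<in> I \<Longrightarrow> x \<in> I \<Longrightarrow> x \<noteq> y \<Longrightarrow>
      ((\<lambda>u. V u y) has_real_derivative D x y) (at x within I)"
    and a: "a \<in> I" and b: "b \<in> I" and c: "c \<in> I" and x: "x \<in> I" and z: "z \<in> I"
  shows "(c - b) * V x a + (a - c) * V x b + (b - a) * V x c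
    = (c - b) * V z a + (a - c) * V z b + (b - a) * V z c"
proof -
  let ?G = "\<lambda>x. (c - b) * V x a + (a - c) * V x b + (b - a) * V x c"
  \<comment> \<open>The endpoints of \<open>I\<close> that belong to it; there the first-order condition is not available.\<close>
  define L U where "L = {t \<in> I. \<forall>z\<in>I. t \<le> z}" and "U = {t \<in> I. \<forall>z\<in>I. z \<le> t}"
  have fin: "finite L" "finite U"
  proof -
    have single: "finite A" if eq: "\<And>t t'. t \<in> A \<Longrightarrow> t' \<in> A \<Longrightarrow> t = t'" for A :: "real set"
    proof -
      obtain t where "A \<subseteq> {t}" using eq by blast
      then show ?thesis by (rule finite_subset) simp
    qed
    show "finite L" "finite U" by (rule single, force simp: L_def U_def intro: antisym)+
  qed
  have G0: "(?G has_derivative (\<lambda>h. 0)) (at t within I)" if t: "t \<in> I - ({a, b, c} \<union> L \<union> U)" for t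
  proof -
    obtain l u where "l \<in> I" "l < t" "u \<in> I" "t < u" using t by (auto simp: L_def U_def not_le)
    then obtain h where h: "\<And>y. y \<in> I \<Longrightarrow> y \<noteq> t \<Longrightarrow> D t y = h * (t - y)"
      using mean_consistent_derivative[where V = V and D = D and x = t] I min der t by blast
    have "(?G has_real_derivative (c - b) * D t a + (a - c) * D t b + (b - a) * D t c) (at t within I)"
      using der[OF a, of t] der[OF b, of t] der[OF c, of t] t by (auto intro!: derivative_eq_intros)
    moreover have "(c - b) * D t a + (a - c) * D t b + (b - a) * D t c = 0"
    proof -
      have "D t a = h * (t - a)" "D t b = h * (t - b)" "D t c = h * (t - c)"
        using h a b c t by auto
      then show ?thesis by (simp only:) (simp add: algebra_simps)
    qed
    ultimately show ?thesis by (simp add: has_field_derivative_def lambda_zero)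
  qed
  show ?thesis
    by (rule has_derivative_zero_unique_strong_convex[where S = I and K = "{a, b, c} \<union> L \<union> U" and f = ?G and c = z])
      (use I fin cont a b c x z G0 in \<open>auto simp: is_interval_convex intro!: continuous_intros\<close>)
qed

text \<open>Any one section \<open>\<phi> = V z\<close> serves as potential. Constancy of the combination for the points \<open>x\<close>, \<open>w\<close>, \<open>y\<close>
  expresses \<open>V x y - \<phi> y\<close> through its values at \<open>x\<close> and at an auxiliary point \<open>w\<close>, as an affine function of \<open>y\<close>;
  \<open>V x x = 0\<close> determines its constant term.\<close>

lemma mean_consistent_Bregman:
  fixes V :: "real \<Rightarrow> real \<Rightarrow> real"
  assumes I: "is_interval I"
    and min: "\<And>a b m x. \<lbrakk>a \<in> I; b \<in> I; m \<in> I; x \<in> I; a < m; m < b\<rbrakk> \<Longrightarrow>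
      (b - m) * V m a + (m - a) * V m b \<le> (b - m) * V x a + (m - a) * V x b"
    and cont: "\<And>y. y \<in> I \<Longrightarrow> continuous_on I (\<lambda>x. V x y)"
    and der: "\<And>y x. y \<in> I \<Longrightarrow> x \<in> I \<Longrightarrow> x \<noteq> y \<Longrightarrow>
      ((\<lambda>u. V u y) has_real_derivative D x y) (at x within I)"
    and zero: "\<And>x. x \<in> I \<Longrightarrow> V x x = 0"
  obtains \<phi> \<phi>' where "\<And>x y. x \<in> I \<Longrightarrow> y \<in> I \<Longrightarrow> V x y = \<phi> y - tangent \<phi> \<phi>' x y"
proof (cases "I = {}")
  case True
  then show ?thesis using that by blast
next
  case False
  then obtain z where z: "z \<in> I" by blast
  define \<phi> where "\<phi> = V z"
  have "\<exists>k. \<forall>y\<in>I. V x y = \<phi> y - (\<phi> x + k * (y - x))" if x: "x \<in> I" for x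
  proof (cases "I = {x}")
    case True
    then show ?thesis using zero by auto
  next
    case False
    then obtain w where w: "w \<in> I" "w \<noteq> x" using x by blast
    define k where "k = (\<phi> w - \<phi> x - V x w) / (w - x)"
    have k: "V x w = \<phi> w - \<phi> x - k * (w - x)" using w by (simp add: k_def)
    have "V x y = \<phi> y - (\<phi> x + k * (y - x))" if y: "y \<in> I" for y
    proof -
      have "(y - w) * V x x + (x - y) * V x w + (w - x) * V x y
          = (y - w) * V z x + (x - y) * V z w + (w - x) * V z y"
        using mean_consistent_combination_constant[where V = V and D = D] I min cont der x w(1) y z
        by blast
      then have "(w - x) * (V x y - (\<phi> y - (\<phi> x + k * (y - x)))) = 0"
        by (simp add: zero[OF x] k \<phi>_def[symmetric] algebra_simps)
      then show ?thesis using w(2) by simp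
    qed
    then show ?thesis by blast
  qed
  then obtain \<phi>' where "\<And>x y. x \<in> I \<Longrightarrow> y \<in> I \<Longrightarrow> V x y = \<phi> y - (\<phi> x + \<phi>' x * (y - x))"
    by metis
  then show ?thesis using that[of \<phi> \<phi>'] by (simp add: tangent_def)
qed

section \<open>Necessity of the form \<open>(\<ast>)\<close>\<close>

text \<open>Dividing by \<open>s(y)\<close> reduces the claim to the mean; nonnegativity of the score is the subgradient
  inequality.\<close>

lemma consistent_imp_ratio_score_form:
  assumes I: "is_interval I"
    and meas: "r \<in> borel_measurable (restrict_space borel I)"
      "s \<in> borel_measurable (restrict_space borel I)"
    and pos: "\<forall>y\<in>I. 0 < s y" and r: "\<forall>y\<in>I. r y = y * s y"
    and score: "scoring_function I S" and S0: "S0 I S" and S1: "S1 I S" and S2: "S2 I S"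
    and cons: "consistent I (compactly_supported_on I) (ratio_functional r s) S"
  obtains \<phi> \<phi>' where "convex_on I \<phi>" "subgradient_on I \<phi> \<phi>'" "ratio_score_form I r s \<phi> \<phi>' S"
proof -
  define V where "V x y = S x y / s y" for x y
  obtain D where D: "\<And>x y. y \<in> I \<Longrightarrow> x \<in> I \<Longrightarrow> x \<noteq> y \<Longrightarrow>
      ((\<lambda>u. S u y) has_real_derivative D x y) (at x within I)"
    using S2 unfolding S2_def by blast
  have min: "(b - m) * V m a + (m - a) * V m b \<le> (b - m) * V x a + (m - a) * V x b"
    if "a \<in> I" "b \<in> I" "m \<in> I" "x \<in> I" "a < m" "m < b" for a b m x
    unfolding V_def using consistent_two_point[OF meas pos r score cons] that by blast
  have cont: "continuous_on I (\<lambda>x. V x y)" if "y \<in> I" for y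
    unfolding V_def using S1 that pos by (intro continuous_intros) (auto simp: S1_def)
  have der: "((\<lambda>u. V u y) has_real_derivative D x y / s y) (at x within I)"
    if "y \<in> I" "x \<in> I" "x \<noteq> y" for x y
    unfolding V_def using DERIV_cdivide[OF D[OF that]] .
  have zero: "V x x = 0" if "x \<in> I" for x
    using S0 that by (simp add: V_def S0_def)
  obtain \<phi> \<phi>' where V: "\<And>x y. x \<in> I \<Longrightarrow> y \<in> I \<Longrightarrow> V x y = \<phi> y - tangent \<phi> \<phi>' x y"
    using mean_consistent_Bregman[where V = V and D = "\<lambda>x y. D x y / s y"] I min cont der zero
    by blast
  have "subgradient_on I \<phi> \<phi>'"
    unfolding subgradient_on_def
  proof (intro ballI)
    fix x y assume x: "x \<in> I" and y: "y \<in> I"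
    have "0 \<le> S x y" using S0 x y unfolding S0_def by blast
    moreover have "0 < s y" using pos y by blast
    ultimately have "0 \<le> V x y" by (simp add: V_def)
    then show "\<phi> x + \<phi>' x * (y - x) \<le> \<phi> y" using V[OF x y] by (simp add: tangent_def)
  qed
  moreover have "ratio_score_form I r s \<phi> \<phi>' S"
    unfolding ratio_score_form_def
  proof (intro ballI)
    fix x y assume x: "x \<in> I" and y: "y \<in> I"
    have "0 < s y" using pos y by blast
    then have "S x y = s y * V x y" by (simp add: V_def)
    then show "S x y = s y * (\<phi> y - \<phi> x) - \<phi>' x * (r y - x * s y) + \<phi>' y * (r y - y * s y)"
      using r y by (simp add: V[OF x y] tangent_def algebra_simps)
  qed
  ultimately show ?thesis
    using that subgradient_imp_convex_on I by (simp add: is_interval_convex)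
qed

theorem theorem3p2:
  fixes I :: "real set" and r s :: "real \<Rightarrow> real"
  assumes "is_interval I"
    and "r \<in> borel_measurable (restrict_space borel I)"
    and "s \<in> borel_measurable (restrict_space borel I)"
    and "\<forall>y\<in>I. 0 < s y"
  shows
    "((\<forall>F\<in>ratio_class I r s. ratio_functional r s F \<in> I) \<longrightarrow>
       elicitable I (ratio_class I r s) (ratio_functional r s))
     \<and>
     (\<forall>\<phi> \<phi>' S.
       convex_on I \<phi> \<and> subgradient_on I \<phi> \<phi>' \<and> ratio_score_form I r s \<phi> \<phi>' S \<and>
       (\<forall>F\<in>ratio_score_class I r s \<phi> \<phi>'. ratio_functional r s F \<in> I) \<longrightarrow>
       consistent I (ratio_score_class I r s \<phi> \<phi>') (ratio_functional r s) S \<and>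
       (strictly_convex_on I \<phi> \<longrightarrow>
          strictly_consistent I (ratio_score_class I r s \<phi> \<phi>') (ratio_functional r s) S))
     \<and>
     (\<forall>S.
       scoring_function I S \<and> S0 I S \<and> S1 I S \<and> S2 I S \<and>
       continuous_on I s \<and> (\<forall>y\<in>I. r y = y * s y) \<and>
       (\<forall>F\<in>compactly_supported_on I. ratio_functional r s F \<in> I) \<longrightarrow>
       (consistent I (compactly_supported_on I) (ratio_functional r s) S \<longleftrightarrow>
          (\<exists>\<phi> \<phi>'. convex_on I \<phi> \<and> subgradient_on I \<phi> \<phi>' \<and>
             ratio_score_form I r s \<phi> \<phi>' S)))"
proof (intro conjI allI impI; (elim conjE)?)
  show "elicitable I (ratio_class I r s) (ratio_functional r s)"
    if "\<forall>F\<in>ratio_class I r s. ratio_functional r s F \<in> I"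
    using ratio_elicitable[OF assms(2-4) that] .
next
  fix \<phi> \<phi>' S
  assume sub: "subgradient_on I \<phi> \<phi>'" "ratio_score_form I r s \<phi> \<phi>' S"
    "\<forall>F\<in>ratio_score_class I r s \<phi> \<phi>'. ratio_functional r s F \<in> I"
  show "consistent I (ratio_score_class I r s \<phi> \<phi>') (ratio_functional r s) S"
    using ratio_score_consistent(1)[OF assms(4) sub] .
  show "strictly_consistent I (ratio_score_class I r s \<phi> \<phi>') (ratio_functional r s) S"
    if "strictly_convex_on I \<phi>"
    using ratio_score_consistent(2)[OF assms(4) sub that] .
next
  fix S
  assume score: "scoring_function I S" and S012: "S0 I S" "S1 I S" "S2 I S"
    and s: "continuous_on I s" and r: "\<forall>y\<in>I. r y = y * s y"
    and T: "\<forall>F\<in>compactly_supported_on I. ratio_functional r s F \<in> I"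
  show "consistent I (compactly_supported_on I) (ratio_functional r s) S \<longleftrightarrow>
      (\<exists>\<phi> \<phi>'. convex_on I \<phi> \<and> subgradient_on I \<phi> \<phi>' \<and> ratio_score_form I r s \<phi> \<phi>' S)"
    using consistent_imp_ratio_score_form[OF assms(1-4) r score S012]
      ratio_score_consistent_compactly_supported[OF assms(2-4) s r T score] by metis
qed

end
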